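(* Let $W$ be a step-graphon and let $\sigma=(\sigma_0,\ldots,\sigma_q)$ be a partition for $W$. Let $S$ and $x^*$ be the associated skeleton graph and concentration vector, respectively, and assume that $S$ is connected. Let $G_n\sim W$ and let $\vec G_n$ be the directed version of $G_n$. If $S$ has no odd cycle or if $x^*\notin \mathcal{X}(S)$, then $$\lim_{n\to\infty}\mathbb{P}(\vec G_n \text{ has a Hamiltonian decomposition}) = 0.$$
   Context: A graphon is a symmetric measurable function $W:[0,1]^2\to[0,1]$. It is a step-graphon if there is a sequence $0=\sigma_0<\sigma_1<\cdots<\sigma_q=1$ such that $W$ is constant on each rectangle $[\sigma_i,\sigma_{i+1})\times[\sigma_j,\sigma_{j+1})$, $0\le i,j\le q-1$; such a sequence $\sigma=(\sigma_0,\ldots,\sigma_q)$ is called a partition for $W$. Sampling: $G_n=(V,E)\sim W$ is the random undirected graph on $n$ nodes $v_1,\dots,v_n$ obtained by (1) sampling $y_1,\ldots,y_n$ independently and uniformly from $[0,1]$, and (2) for any two distinct nodes $v_i,v_j$, placing (independently over unordered pairs) an edge $(v_i,v_j)\in E$ with probability $W(y_i,y_j)$. $G_n$ has no self-loops. Directed version: $\vec G_n=(V,\vec E)$ with $\vec E=\{v_iv_j,\ v_jv_i \mid (v_i,v_j)\in E\}$. Hamiltonian decomposition: $\vec G_n$ has a Hamiltonian decomposition if it contains a subgraph $\vec H=(V,\vec E')$ with the same node set such that $\vec H$ is a disjoint union of directed cycles (node-disjoint directed cycles covering all nodes; 2-cycles $v_iv_j, v_jv_i$ are allowed). Concentration vector: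 $x^*=(x_1^*,\ldots,x_q^* )$ with $x_i^*=\sigma_i-\sigma_{i-1}$. Skeleton graph: $S=(U,F)$ is the undirected graph, possibly with self-loops, on nodes $U=\{u_1,\ldots,u_q\}$, with an edge between $u_i$ and $u_j$ ($i=j$ allowed, giving a self-loop) if and only if $W$ is non-zero on $[\sigma_{i-1},\sigma_i)\times[\sigma_{j-1},\sigma_j)$. Odd cycle: a cycle in $S$ with an odd number of nodes/edges; a self-loop counts as a cycle of length 1. Edge polytope: write $F=\{f_1,\ldots,f_{|F|}\}=F_0\cup F_1$ with $F_0$ the self-loops and $F_1$ the edges between distinct nodes. For each $j$ let $z_j\in\mathbb{R}^q$ be the vector with $z_j=e_i$ if $f_j$ is a loop on $u_i$, and $z_j=\tfrac12(e_k+e_\ell)$ if $f_j=(u_k,u_\ell)$ with $k\neq \ell$, where $e_1,\dots,e_q$ is the standard basis. Then $\mathcal{X}(S)=\operatorname{conv}\{z_j\mid j=1,\ldots,|F|\}$. *)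

theory Defs
  imports "HOL-Probability.Probability" "HOL-Analysis.Finite_Function_Topology" "Graph_Theory.Digraph_Component"
begin

section \<open>Step-graphons\<close>

definition graphon :: "(real \<times> real \<Rightarrow> real) \<Rightarrow> bool" where
  "graphon W \<longleftrightarrow>
     W \<in> borel_measurable (lebesgue_on ({0..1} \<times> {0..1})) \<and>
     W \<in> {0..1} \<times> {0..1} \<rightarrow> {0..1} \<and>
     (\<forall>x\<in>{0..1}. \<forall>y\<in>{0..1}. W (x, y) = W (y, x))"

text \<open>Blocks are numbered from 0, so block \<open>i\<close> is \<open>[\<sigma>\<^sub>i, \<sigma>\<^sub>i\<^sub>+\<^sub>1)\<close> for \<open>i < q\<close>;
  only the values \<open>\<sigma> 0, \<dots>, \<sigma> q\<close> are relevant.\<close>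

definition rectangle :: "(nat \<Rightarrow> real) \<Rightarrow> nat \<Rightarrow> nat \<Rightarrow> (real \<times> real) set" where
  "rectangle \<sigma> i j = {\<sigma> i..<\<sigma> (Suc i)} \<times> {\<sigma> j..<\<sigma> (Suc j)}"

definition partition_for :: "(real \<times> real \<Rightarrow> real) \<Rightarrow> nat \<Rightarrow> (nat \<Rightarrow> real) \<Rightarrow> bool" where
  "partition_for W q \<sigma> \<longleftrightarrow>
     \<sigma> 0 = 0 \<and> \<sigma> q = 1 \<and> (\<forall>i<q. \<sigma> i < \<sigma> (Suc i)) \<and>
     (\<forall>i<q. \<forall>j<q. W constant_on rectangle \<sigma> i j)"

definition step_graphon :: "(real \<times> real \<Rightarrow> real) \<Rightarrow> bool" where
  "step_graphon W \<longleftrightarrow> graphon W \<and> (\<exists>q \<sigma>. partition_for W q \<sigma>)"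

section \<open>Undirected graphs\<close>

text \<open>An undirected graph is given by a node set and a set of edges \<open>{u, v}\<close>; the case
  \<open>u = v\<close> is a self-loop. Its directed version contains both orientations of every edge.\<close>

definition directed_version :: "'a set \<Rightarrow> 'a set set \<Rightarrow> 'a pair_pre_digraph" where
  "directed_version V E = \<lparr>pverts = V, parcs = {(u, v). {u, v} \<in> E}\<rparr>"

text \<open>Qualified because topological connectedness in HOL-Analysis has the same name.\<close>

definition connected_graph :: "'a set \<Rightarrow> 'a set set \<Rightarrow> bool" where
  "connected_graph V E \<longleftrightarrow> Digraph_Component.connected (with_proj (directed_version V E))"

text \<open>The cycles of an undirected graph are those of its directed version, except that
  traversing one edge back and forth is a cycle (of length 2) only in the latter. Being even,
  these 2-cycles do not matter here. A self-loop is a cycle of length 1.\<close>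

definition has_odd_cycle :: "'a set \<Rightarrow> 'a set set \<Rightarrow> bool" where
  "has_odd_cycle V E \<longleftrightarrow>
     (\<exists>p. pre_digraph.cycle (with_proj (directed_version V E)) p \<and> odd (length p))"

section \<open>Skeleton graph, concentration vector and edge polytope\<close>

definition skeleton_edges :: "(real \<times> real \<Rightarrow> real) \<Rightarrow> nat \<Rightarrow> (nat \<Rightarrow> real) \<Rightarrow> nat set set" where
  "skeleton_edges W q \<sigma> =
     {{i, j} | i j. i < q \<and> j < q \<and> (\<forall>z\<in>rectangle \<sigma> i j. W z \<noteq> 0)}"

text \<open>As \<open>q\<close> is not a type, \<open>\<real>\<^sup>q\<close> is identified with the subspace of vectors supported on
  \<open>{..<q}\<close> in the real vector space of finitely supported functions on the naturals;
  \<open>Poly_Mapping.single i 1\<close> is the standard basis vector with index \<open>i\<close>.\<close>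

definition concentration_vector :: "nat \<Rightarrow> (nat \<Rightarrow> real) \<Rightarrow> (nat, real) poly_mapping" where
  "concentration_vector q \<sigma> = (\<Sum>i<q. Poly_Mapping.single i (\<sigma> (Suc i) - \<sigma> i))"

definition edge_polytope :: "'a set set \<Rightarrow> ('a, real) poly_mapping set" where
  "edge_polytope F = convex hull
     ({Poly_Mapping.single i 1 | i. {i} \<in> F} \<union>
      {(1/2) *\<^sub>R (Poly_Mapping.single k 1 + Poly_Mapping.single l 1) | k l. k \<noteq> l \<and> {k, l} \<in> F})"

section \<open>Sampling from a graphon\<close>

text \<open>The edge set of the graph on the nodes \<open>{..<n}\<close>, given the samples \<open>y 0, \<dots>, y (n - 1)\<close>.\<close>

definition edges_given :: "(real \<times> real \<Rightarrow> real) \<Rightarrow> nat \<Rightarrow> (nat \<Rightarrow> real) \<Rightarrow> nat set set pmf" where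
  "edges_given W n y =
     map_pmf (\<lambda>b. {{i, j} | i j. i < j \<and> j < n \<and> b (i, j)})
       (Pi_pmf {(i, j). i < j \<and> j < n} False (\<lambda>(i, j). bernoulli_pmf (W (y i, y j))))"

text \<open>A graphon is only assumed to be Lebesgue measurable on the unit square, so
  \<open>\<lambda>y. W (y i, y j)\<close> is measurable with respect to the completed product measure, but not
  necessarily with respect to the product measure itself.\<close>

definition sample_edges :: "(real \<times> real \<Rightarrow> real) \<Rightarrow> nat \<Rightarrow> nat set set measure" where
  "sample_edges W n =
     completion (\<Pi>\<^sub>M i\<in>{..<n}. uniform_measure lborel {0..1}) \<bind>
       (\<lambda>y. measure_pmf (edges_given W n y))"

section \<open>Hamiltonian decompositions\<close>

definition disjoint_union_of_cycles :: "'a pair_pre_digraph \<Rightarrow> bool" where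
  "disjoint_union_of_cycles H \<longleftrightarrow>
     (\<exists>C. (\<forall>p\<in>C. pre_digraph.cycle (with_proj H) p) \<and>
          disjoint_family_on (\<lambda>p. fst ` set p) C \<and>
          pverts H = (\<Union>p\<in>C. fst ` set p) \<and>
          parcs H = (\<Union>p\<in>C. set p))"

definition has_hamiltonian_decomposition :: "'a pair_pre_digraph \<Rightarrow> bool" where
  "has_hamiltonian_decomposition G \<longleftrightarrow>
     (\<exists>H. spanning (with_proj H) (with_proj G) \<and> disjoint_union_of_cycles H)"

end

theory Submission
  imports Defs "HOL-Real_Asymp.Real_Asymp"
begin

text \<open>A Hamiltonian decomposition of a graph is a permutation \<open>\<pi>\<close> of its nodes that moves
  every node along an edge (\<open>hamiltonian_decomposition_permutation\<close>). Almost surely, an edge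
  of the sampled graph joins nodes in blocks that are adjacent in the skeleton. A Hamiltonian
  decomposition therefore forces a rigid relation on the numbers of samples in the blocks, which
  under either of the two hypotheses has vanishing probability.

  If the skeleton has no odd cycle, it is connected and hence has a proper two-colouring
  (\<open>two_colouring_if_no_odd_cycle\<close>). Then \<open>\<pi>\<close> exchanges the nodes of the two colours,
  so exactly half of the \<open>n\<close> nodes have the first colour. The number of such nodes is
  binomial, and a binomial variable equals \<open>n/2\<close> with probability at most
  \<open>1 / sqrt (n + 1)\<close> (\<open>prob_binomial_half_le\<close>).

  In general, the empirical distribution of the nodes over the blocks is the average of the midpoints
  of the skeleton edges used by \<open>\<pi>\<close>, and so lies in the edge polytope
  (\<open>empirical_vector_in_edge_polytope\<close>). The polytope is closed. If it does not contain the
  concentration vector, the empirical distribution must deviate from its mean by a fixed amount in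
  some coordinate, which Hoeffding's inequality for the binomial distribution makes exponentially
  unlikely.

  To work with binomial distributions, the sampling is first rewritten as a discrete experiment
  (\<open>sample_edges_eq_block_model\<close>): as the graphon is constant on rectangles, the samples
  matter only through their blocks, which are independent and distributed according to the
  concentration vector.\<close>

section \<open>Two-colourings of graphs without odd cycles\<close>

text \<open>A closed walk that is not a cycle revisits a vertex and so splits into two shorter closed walks.
  Their lengths add up to an odd number, hence one of the two is odd again.\<close>

lemma (in wf_digraph) odd_closed_awalk_contains_odd_cycle:
  assumes "awalk u p u" "odd (length p)"
  shows "\<exists>c. cycle c \<and> odd (length c)"
  using assms
proof (induction "length p" arbitrary: u p rule: less_induct)
  case less
  show ?case
  proof (cases "distinct (tl (awalk_verts u p))")
    case True
    then show ?thesis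
      using less.prems by (force simp: cycle_def)
  next
    case False
    \<comment> \<open>The base point occurs at both ends of the walk, so the first arc is split off to make every
      repeated vertex a genuine revisit.\<close>
    obtain e es where p: "p = e # es"
      using less.prems(2) by (cases p) auto
    have rest: "awalk (head G e) es u" "\<not> distinct (awalk_verts (head G e) es)"
      using False less.prems(1) by (auto simp: p awalk_Cons_iff)
    obtain a r b w where es: "es = a @ r @ b" and "0 < length r"
      and w: "awalk (head G e) a w" "awalk w r w" "awalk w b u"
      using awalk_not_distinct_decomp[OF rest] by metis
    show ?thesis
    proof (cases "odd (length r)")
      case True
      then show ?thesis
        using less.hyps[of r w] w(2) by (simp add: p es)
    next
      case False
      have "awalk u (e # a @ b) u"
        using less.prems(1) w awalk_appendI[OF w(1,3)] by (simp add: p awalk_Cons_iff)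
      moreover have "odd (length (e # a @ b))"
        using False less.prems(2) by (simp add: p es)
      ultimately show ?thesis
        using less.hyps[of "e # a @ b" u] \<open>0 < length r\<close> by (simp add: p es)
    qed
  qed
qed

text \<open>Colour a vertex by whether an even walk leads to it from a fixed root. Closing up two walks that
  end at the same vertex by a common way back shows that their lengths have the same parity, since
  there is no odd closed walk; hence the two ends of an edge get different colours.\<close>

lemma two_colouring_if_no_odd_cycle:
  assumes "\<Union>E \<subseteq> V"
    and "connected_graph V E" "\<not> has_odd_cycle V E"
  obtains c :: "'a \<Rightarrow> bool" where "\<And>u v. {u, v} \<in> E \<Longrightarrow> c u \<noteq> c v"
proof -
  let ?G = "with_proj (directed_version V E)"
  interpret wf_digraph ?G
    using assms(1) by unfold_locales (auto simp: directed_version_def)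
  have "symmetric ?G"
    by (auto simp: symmetric_def sym_def directed_version_def insert_commute)
  then have "reachable (with_proj (mk_symmetric ?G)) u v \<longleftrightarrow> (\<exists>p. awalk u p v)" for u v
    by (simp only: reachable_mk_symmetric_eq reachable_awalk)
  moreover have "pverts (mk_symmetric ?G) = V"
    by (simp add: mk_symmetric_def directed_version_def)
  ultimately have nonempty: "V \<noteq> {}"
    and reach: "\<And>u v. u \<in> V \<Longrightarrow> v \<in> V \<Longrightarrow> \<exists>p. awalk u p v"
    using assms(2) by (simp_all add: connected_graph_def connected_def strongly_connected_def)
  have even_closed: "even (length p)" if "awalk u p u" for u p
    using odd_closed_awalk_contains_odd_cycle[OF that] assms(3) by (auto simp: has_odd_cycle_def)
  obtain r where "r \<in> V"
    using nonempty by blast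
  define c where "c v \<longleftrightarrow> (\<exists>p. awalk r p v \<and> even (length p))" for v
  have "c u \<noteq> c v" if uv: "{u, v} \<in> E" for u v
  proof -
    have "u \<in> V" "v \<in> V"
      using assms(1) uv by auto
    obtain p where p: "awalk r p u"
      using reach \<open>r \<in> V\<close> \<open>u \<in> V\<close> by blast
    \<comment> \<open>A common way back to the root; only its parity relative to the other walks matters.\<close>
    obtain w where w: "awalk v w r"
      using reach \<open>r \<in> V\<close> \<open>v \<in> V\<close> by blast
    have step: "awalk r (p' @ [(u, v)]) v" if "awalk r p' u" for p'
    proof (rule awalk_appendI[OF that])
      show "awalk u [(u, v)] v"
        unfolding awalk_Cons_iff awalk_Nil_iff using \<open>v \<in> V\<close> uv by (simp add: directed_version_def)
    qed
    show ?thesis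
    proof
      assume eq: "c u = c v"
      show False
      proof (cases "c u")
        case True
        then obtain p1 p2 where p1: "awalk r p1 u" "even (length p1)"
          and p2: "awalk r p2 v" "even (length p2)"
          using eq unfolding c_def by blast
        have "even (length ((p1 @ [(u, v)]) @ w))" "even (length (p2 @ w))"
          using even_closed awalk_appendI[OF step[OF p1(1)] w] awalk_appendI[OF p2(1) w] by blast+
        with p1(2) p2(2) show False by simp
      next
        case False
        then have "odd (length p)"
          using p by (auto simp: c_def)
        then have "c v"
          using step[OF p] unfolding c_def by (intro exI[of _ "p @ [(u, v)]"]) simp
        then show False
          using False eq by simp
      qed
    qed
  qed
  then show ?thesis by (rule that)
qed

section \<open>Hamiltonian decompositions as permutations\<close>

text \<open>The heads of a closed walk are its tails, shifted by one position. Both lists therefore have the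
  same entries with the same multiplicities, and a cycle is distinct in its heads.\<close>

lemma cycle_arcs_permutation:
  assumes "wf_digraph (with_proj H)" "pre_digraph.cycle (with_proj H) p"
  shows "inj_on fst (set p)" "inj_on snd (set p)" "snd ` set p = fst ` set p"
proof -
  interpret wf_digraph "with_proj H" by fact
  obtain u where walk: "awalk u p u" and dist: "distinct (tl (awalk_verts u p))" and "p \<noteq> []"
    using assms(2) by (auto simp: cycle_def)
  have verts: "awalk_verts u p = map fst p @ [snd (last p)]" "awalk_verts u p = fst (hd p) # map snd p"
    using awalk_verts_conv[of u p] awalk_verts_conv'[of u p u] walk \<open>p \<noteq> []\<close> by auto
  have "fst (hd p) = u" "snd (last p) = u"
    using awends_of_awalk[OF walk] verts by (auto simp: verts)
  \<comment> \<open>The vertex list of the closed walk, read once by tails and once by heads, starts and ends in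
    \<open>u\<close>.\<close>
  then have mset: "mset (map fst p) = mset (map snd p)"
    using arg_cong[OF verts(2)[unfolded verts(1)], of mset] by simp
  have snd: "distinct (map snd p)"
    using dist by (simp add: verts(2))
  have fst: "distinct (map fst p)"
    using mset_eq_imp_distinct_iff[OF mset] snd by blast
  from fst snd mset_eq_setD[OF mset] show "inj_on fst (set p)" "inj_on snd (set p)" "snd ` set p = fst ` set p"
    by (simp_all add: distinct_map)
qed

text \<open>In a disjoint union of cycles that covers all nodes, every node has exactly one successor and
  exactly one predecessor, so passing to the successor permutes the nodes. Of a Hamiltonian
  decomposition, this permutation along edges is all that the two obstructions below see.\<close>

lemma hamiltonian_decomposition_permutation:
  assumes "has_hamiltonian_decomposition (directed_version V E)"
  obtains \<pi> where "bij_betw \<pi> V V" "\<And>v. v \<in> V \<Longrightarrow> {v, \<pi> v} \<in> E"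
proof -
  obtain H C where span: "spanning (with_proj H) (with_proj (directed_version V E))"
    and cyc: "\<And>p. p \<in> C \<Longrightarrow> pre_digraph.cycle (with_proj H) p"
    and disj: "disjoint_family_on (\<lambda>p. fst ` set p) C"
    and verts: "pverts H = (\<Union>p\<in>C. fst ` set p)" and arcs: "parcs H = (\<Union>p\<in>C. set p)"
    using assms by (auto simp: has_hamiltonian_decomposition_def disjoint_union_of_cycles_def)
  have wf: "wf_digraph (with_proj H)" and V: "pverts H = V" and sub: "parcs H \<subseteq> {(u, v). {u, v} \<in> E}"
    using span by (auto simp: spanning_def subgraph_def directed_version_def)
  note perm = cycle_arcs_permutation[OF wf cyc]
  have fst: "bij_betw fst (parcs H) V"
    unfolding arcs V[symmetric] verts
    by (intro bij_betw_UNION_disjoint disj) 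
       (simp_all add: bij_betw_def perm)
  have snd: "bij_betw snd (parcs H) V"
    unfolding arcs V[symmetric] verts
    by (intro bij_betw_UNION_disjoint disj) 
       (simp_all add: bij_betw_def perm)
  show ?thesis
  proof (rule that)
    show "bij_betw (snd \<circ> inv_into (parcs H) fst) V V"
      using bij_betw_trans[OF bij_betw_inv_into[OF fst] snd] .
    show "{v, (snd \<circ> inv_into (parcs H) fst) v} \<in> E" if "v \<in> V" for v
    proof -
      have "inv_into (parcs H) fst v \<in> parcs H" "fst (inv_into (parcs H) fst v) = v"
        using fst that by (auto simp: bij_betw_def inv_into_into f_inv_into_f)
      then show ?thesis
        using sub by (auto simp: case_prod_beta)
    qed
  qed
qed

section \<open>Reduction of the sampling to a discrete block model\<close>

lemma countable_measure_is_pmf: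
  fixes M :: "'a :: countable measure"
  assumes "prob_space M" "sets M = UNIV"
  obtains P where "measure_pmf P = M"
proof -
  interpret prob_space M by fact
  have "(\<Union>x\<in>{x. measure M {x} = 0}. {x}) \<in> null_sets M"
    using assms(2) by (intro null_sets_UN') (auto simp: null_sets_def emeasure_eq_measure)
  then have "AE x in M. measure M {x} \<noteq> 0"
    by (rule AE_I') auto
  then show ?thesis
    using assms by (intro that[of "Abs_pmf M"] Abs_pmf_inverse) auto
qed

text \<open>Independent discrete observations of independent samples form a product of mass functions. The
  values off \<open>I\<close> are the default \<open>d\<close>, which is how \<^const>\<open>Pi_pmf\<close> represents a
  function on \<open>I\<close>. The functions with this default form a countable set, so it suffices
  to compare the two measures on single functions, where both are finite products.\<close>

lemma distr_PiM_eq_Pi_pmf: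
  fixes X :: "'a \<Rightarrow> 'b :: countable" and I :: "'i set"
  assumes "prob_space N" and X: "X \<in> N \<rightarrow>\<^sub>M count_space UNIV"
    and P: "measure_pmf P = distr N (count_space UNIV) X" and "finite I"
  shows "(\<lambda>y i. if i \<in> I then X (y i) else d) \<in> (\<Pi>\<^sub>M i\<in>I. N) \<rightarrow>\<^sub>M count_space UNIV" (is ?meas)
    and "distr (\<Pi>\<^sub>M i\<in>I. N) (count_space UNIV) (\<lambda>y i. if i \<in> I then X (y i) else d) =
         measure_pmf (Pi_pmf I d (\<lambda>_. P))" (is ?distr)
proof -
  interpret N: prob_space N by fact
  interpret product_sigma_finite "\<lambda>_. N" by unfold_locales
  let ?h = "\<lambda>y i. if i \<in> I then X (y i) else d" and ?R = "PiE_dflt I d (\<lambda>_. UNIV :: 'b set)"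
  have "countable ?R"
    unfolding dflt_image_PiE[symmetric]
    using \<open>finite I\<close> by (intro countable_image countable_PiE) auto
  have vimage: "?h -` {a} \<inter> space (\<Pi>\<^sub>M i\<in>I. N) = (\<Pi>\<^sub>E i\<in>I. X -` {a i} \<inter> space N)"
    if "a \<in> ?R" for a
    using that by (auto simp: space_PiM PiE_dflt_def PiE_def Pi_def fun_eq_iff)
  have fibre: "X -` {b} \<inter> space N \<in> sets N" for b
    using X by (rule measurable_sets) simp
  have "?h \<in> (\<Pi>\<^sub>M i\<in>I. N) \<rightarrow>\<^sub>M count_space ?R"
    unfolding measurable_count_space_eq_countable[OF \<open>countable ?R\<close>]
  proof (intro conjI ballI)
    show "?h -` {a} \<inter> space (\<Pi>\<^sub>M i\<in>I. N) \<in> sets (\<Pi>\<^sub>M i\<in>I. N)" if "a \<in> ?R" for a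
      unfolding vimage[OF that] using \<open>finite I\<close> fibre by (intro sets_PiM_I_finite)
  qed (auto simp: PiE_dflt_def)
  then show meas: ?meas
    by (rule measurable_compose) simp
  show ?distr
  proof (rule measure_eqI_countable_AE[OF _ _ _ _ \<open>countable ?R\<close>])
    show "AE f in distr (\<Pi>\<^sub>M i\<in>I. N) (count_space UNIV) ?h. f \<in> ?R"
      using meas by (subst AE_distr_iff) (auto simp: PiE_dflt_def)
    show "AE f in Pi_pmf I d (\<lambda>_. P). f \<in> ?R"
      using set_Pi_pmf_subset'[OF \<open>finite I\<close>, of d "\<lambda>_. P"]
      by (auto simp: AE_measure_pmf_iff PiE_dflt_def)
    fix a assume a: "a \<in> ?R"
    have "emeasure (distr (\<Pi>\<^sub>M i\<in>I. N) (count_space UNIV) ?h) {a} =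
        (\<Prod>i\<in>I. emeasure N (X -` {a i} \<inter> space N))"
      using meas fibre \<open>finite I\<close> by (simp add: emeasure_distr vimage[OF a] emeasure_PiM)
    also have "\<dots> = (\<Prod>i\<in>I. emeasure (measure_pmf P) {a i})"
      using X by (simp add: P emeasure_distr)
    also have "\<dots> = emeasure (Pi_pmf I d (\<lambda>_. P)) {a}"
      using a \<open>finite I\<close>
      by (simp add: emeasure_pmf_single pmf_Pi prod_ennreal PiE_dflt_def)
    finally show "emeasure (distr (\<Pi>\<^sub>M i\<in>I. N) (count_space UNIV) ?h) {a} =
        emeasure (Pi_pmf I d (\<lambda>_. P)) {a}" .
  qed simp_all
qed

text \<open>This is the point of completing the product measure in the sampling: a null set of exceptional
  points cannot destroy measurability.\<close>

lemma measurable_completion_AE: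
  assumes f: "f \<in> M \<rightarrow>\<^sub>M N" and eq: "AE x in M. g x = f x"
    and g: "\<And>x. x \<in> space M \<Longrightarrow> g x \<in> space N"
  shows "g \<in> completion M \<rightarrow>\<^sub>M N"
proof (rule measurableI)
  fix A assume "A \<in> sets N"
  then have sets: "f -` A \<inter> space M \<in> sets (completion M)"
    using f by (auto intro: sets_completionI_sets)
  have "AE x in completion M. x \<in> f -` A \<inter> space M \<longleftrightarrow> x \<in> g -` A \<inter> space M"
    using AE_completion[OF eq] by eventually_elim auto
  from completion.in_sets_AE[OF this sets]
  show "g -` A \<inter> space (completion M) \<in> sets (completion M)"
    by simp
qed (use g in simp)

text \<open>A kernel that depends, up to a null set, only on a discrete statistic \<open>f\<close> of the sample
  may be driven by the distribution of \<open>f\<close> instead.\<close>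

lemma bind_completion_eq:
  assumes f: "f \<in> M \<rightarrow>\<^sub>M count_space UNIV" and "AE x in M. g x = k (f x)"
    and "prob_space M" and P: "distr M (count_space UNIV) f = measure_pmf P"
  shows "completion M \<bind> (\<lambda>x. measure_pmf (g x)) = measure_pmf (P \<bind> k)"
proof -
  have k: "(\<lambda>b. measure_pmf (k b)) \<in> count_space UNIV \<rightarrow>\<^sub>M subprob_algebra (count_space UNIV)"
    by (simp add: space_subprob_algebra subprob_space_measure_pmf)
  note kf = measurable_compose[OF f k]
  have AE: "AE x in M. measure_pmf (g x) = measure_pmf (k (f x))"
    using assms(2) by eventually_elim simp
  have "completion M \<bind> (\<lambda>x. measure_pmf (g x)) = completion M \<bind> (\<lambda>x. measure_pmf (k (f x)))"
  proof (rule bind_cong_AE[OF refl])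
    show "(\<lambda>x. measure_pmf (g x)) \<in> completion M \<rightarrow>\<^sub>M subprob_algebra (count_space UNIV)"
      using kf AE by (rule measurable_completion_AE)
        (simp add: space_subprob_algebra subprob_space_measure_pmf)
  qed (use measurable_completion[OF kf] AE_completion[OF AE] in simp_all)
  also have "\<dots> = distr (completion M) (count_space UNIV) f \<bind> (\<lambda>b. measure_pmf (k b))"
    using measurable_completion[OF f] k prob_space.not_empty[OF \<open>prob_space M\<close>]
    by (intro bind_distr[symmetric]) simp_all
  also have "\<dots> = measure_pmf (P \<bind> k)"
    using f by (simp add: distr_completion P measure_pmf_bind)
  finally show ?thesis .
qed

text \<open>On \<open>[0,1)\<close>, the index of the block that contains \<open>x\<close>. The least-index form
  makes it Borel measurable on the whole line.\<close>

definition block_of :: "(nat \<Rightarrow> real) \<Rightarrow> real \<Rightarrow> nat" where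
  "block_of \<sigma> x = (LEAST i. x < \<sigma> (Suc i))"

lemma measurable_block_of [measurable]: "block_of \<sigma> \<in> borel \<rightarrow>\<^sub>M count_space UNIV"
  unfolding block_of_def by measurable

lemma partition_for_mono:
  assumes "partition_for W q \<sigma>" "i \<le> j" "j \<le> q"
  shows "\<sigma> i \<le> \<sigma> j"
  using assms(2,3)
proof (induction j rule: dec_induct)
  case (step k)
  then have "\<sigma> k < \<sigma> (Suc k)"
    using assms(1) by (simp add: partition_for_def)
  then show ?case
    using step by simp
qed simp

lemma block_of_bounds:
  assumes "partition_for W q \<sigma>" "x \<in> {0..<1}"
  shows "block_of \<sigma> x < q" "x \<in> {\<sigma> (block_of \<sigma> x)..<\<sigma> (Suc (block_of \<sigma> x))}"
proof -
  have "q \<noteq> 0"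
    using assms(1) by (auto simp: partition_for_def intro: gr0I)
  then have top: "x < \<sigma> (Suc (q - 1))"
    using assms by (simp add: partition_for_def)
  show "block_of \<sigma> x < q"
    using Least_le[of "\<lambda>i. x < \<sigma> (Suc i)", OF top] \<open>q \<noteq> 0\<close> by (simp add: block_of_def)
  have "x < \<sigma> (Suc (block_of \<sigma> x))"
    unfolding block_of_def using top by (rule LeastI)
  moreover have "\<sigma> (block_of \<sigma> x) \<le> x"
  proof (cases "block_of \<sigma> x")
    case 0
    then show ?thesis
      using assms by (simp add: partition_for_def)
  next
    case (Suc k)
    then have "\<not> x < \<sigma> (Suc k)"
      using not_less_Least[of k "\<lambda>i. x < \<sigma> (Suc i)"] by (simp add: block_of_def)
    then show ?thesis
      by (simp add: Suc)
  qed
  ultimately show "x \<in> {\<sigma> (block_of \<sigma> x)..<\<sigma> (Suc (block_of \<sigma> x))}"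
    by simp
qed

lemma block_of_eq_iff:
  assumes "partition_for W q \<sigma>" "x \<in> {0..<1}" "k < q"
  shows "block_of \<sigma> x = k \<longleftrightarrow> x \<in> {\<sigma> k..<\<sigma> (Suc k)}"
proof
  assume x: "x \<in> {\<sigma> k..<\<sigma> (Suc k)}"
  have "block_of \<sigma> x \<le> k"
    unfolding block_of_def using x by (intro Least_le) simp
  moreover have "\<not> block_of \<sigma> x < k"
    using partition_for_mono[OF assms(1), of "Suc (block_of \<sigma> x)" k] x assms(3)
      block_of_bounds(2)[OF assms(1,2)] by auto
  ultimately show "block_of \<sigma> x = k"
    by simp
qed (use block_of_bounds(2)[OF assms(1,2)] in auto)

lemma AE_uniform_unit_interval: "AE x in uniform_measure lborel {0..1}. x \<in> {0..<1::real}"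
proof (rule AE_uniform_measureI)
  show "AE x in lborel. x \<in> {0..1} \<longrightarrow> x \<in> {0..<1::real}"
    using AE_lborel_singleton[of 1] by eventually_elim auto
qed simp

lemma prob_space_uniform_unit_interval: "prob_space (uniform_measure lborel {0..1::real})"
  by (intro prob_space_uniform_measure) simp_all

text \<open>The block of a uniform sample is distributed according to the concentration vector.\<close>

lemma block_pmf_exists:
  assumes part: "partition_for W q \<sigma>"
  obtains P where "measure_pmf P = distr (uniform_measure lborel {0..1}) (count_space UNIV) (block_of \<sigma>)"
    and "set_pmf P \<subseteq> {..<q}" and "\<And>k. k < q \<Longrightarrow> pmf P k = \<sigma> (Suc k) - \<sigma> k"
proof -
  let ?U = "uniform_measure lborel {0..1::real}"
  interpret prob_space ?U by (rule prob_space_uniform_unit_interval)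
  obtain P where P: "measure_pmf P = distr ?U (count_space UNIV) (block_of \<sigma>)"
    by (rule countable_measure_is_pmf[of "distr ?U (count_space UNIV) (block_of \<sigma>)"])
      (simp_all add: prob_space_distr)
  have "AE x in ?U. block_of \<sigma> x < q"
    using AE_uniform_unit_interval by eventually_elim (rule block_of_bounds(1)[OF part])
  then have "AE k in measure_pmf P. k < q"
    unfolding P by (subst AE_distr_iff) simp_all
  then have "set_pmf P \<subseteq> {..<q}"
    by (auto simp: AE_measure_pmf_iff)
  moreover have "pmf P k = \<sigma> (Suc k) - \<sigma> k" if "k < q" for k
  proof -
    have bounds: "0 \<le> \<sigma> k" "\<sigma> k \<le> \<sigma> (Suc k)" "\<sigma> (Suc k) \<le> 1"
      using partition_for_mono[OF part, of 0 k] partition_for_mono[OF part, of k "Suc k"]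
        partition_for_mono[OF part, of "Suc k" q] part \<open>k < q\<close> by (auto simp: partition_for_def)
    have "emeasure (measure_pmf P) {k} = emeasure ?U (block_of \<sigma> -` {k})"
      unfolding P by (subst emeasure_distr) simp_all
    also have "\<dots> = emeasure ?U {\<sigma> k..<\<sigma> (Suc k)}"
      using AE_uniform_unit_interval
    proof (intro emeasure_eq_AE)
      show "AE x in ?U. x \<in> block_of \<sigma> -` {k} \<longleftrightarrow> x \<in> {\<sigma> k..<\<sigma> (Suc k)}"
        using AE_uniform_unit_interval
        by eventually_elim (simp only: vimage_singleton_eq block_of_eq_iff[OF part _ \<open>k < q\<close>])
      show "block_of \<sigma> -` {k} \<in> sets ?U"
        using measurable_sets[OF measurable_block_of, of "{k}"] by simp
    qed simp
    also have "\<dots> = emeasure lborel ({0..1} \<inter> {\<sigma> k..<\<sigma> (Suc k)})"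
      by (simp add: divide_ennreal_def)
    also have "{0..1} \<inter> {\<sigma> k..<\<sigma> (Suc k)} = {\<sigma> k..<\<sigma> (Suc k)}"
      using bounds by auto
    finally show ?thesis
      using bounds by (simp add: emeasure_pmf_single)
  qed
  ultimately show ?thesis
    by (rule that[OF P])
qed

text \<open>The graphon is constant on rectangles, so each sample can be moved to the left end of its block.
  The point 1 lies in no half-open block, which is why it is excluded.\<close>

lemma edges_given_block_representatives:
  assumes part: "partition_for W q \<sigma>" and y: "\<And>i. i < n \<Longrightarrow> y i \<in> {0..<1}"
    and b: "\<And>i. i < n \<Longrightarrow> b i = block_of \<sigma> (y i)"
  shows "edges_given W n y = edges_given W n (\<sigma> \<circ> b)"
proof -
  have "W (y i, y j) = W (\<sigma> (b i), \<sigma> (b j))" if "i < n" "j < n" for i j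
  proof -
    have less: "b i < q" "b j < q" and mem: "(y i, y j) \<in> rectangle \<sigma> (b i) (b j)"
      using block_of_bounds[OF part y] b that by (auto simp: rectangle_def)
    moreover have "(\<sigma> (b i), \<sigma> (b j)) \<in> rectangle \<sigma> (b i) (b j)"
      using part less by (simp add: rectangle_def partition_for_def)
    ultimately show ?thesis
      using part unfolding partition_for_def constant_on_def by metis
  qed
  then show ?thesis
    unfolding edges_given_def
    by (intro arg_cong[of _ _ "map_pmf _"] Pi_pmf_cong) (auto intro!: arg_cong[of _ _ bernoulli_pmf])
qed

text \<open>Up to the null event that some sample equals 1, the random graph depends on the samples only
  through their blocks. The sampling thus becomes a purely discrete experiment: draw independent
  blocks, then place the edges. All measurability questions are settled here.\<close>

lemma sample_edges_eq_block_model: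
  assumes part: "partition_for W q \<sigma>"
    and distr_block: "measure_pmf P = distr (uniform_measure lborel {0..1}) (count_space UNIV) (block_of \<sigma>)"
  shows "sample_edges W n =
    measure_pmf (Pi_pmf {..<n} 0 (\<lambda>_. P) \<bind> (\<lambda>b. edges_given W n (\<sigma> \<circ> b)))"
proof -
  let ?U = "uniform_measure lborel {0..1::real}"
  interpret product_prob_space "\<lambda>_. ?U" "{..<n}"
    by (intro product_prob_spaceI prob_space_uniform_unit_interval)
  let ?b = "\<lambda>y i. if i \<in> {..<n} then block_of \<sigma> (y i) else 0"
  have block: "block_of \<sigma> \<in> ?U \<rightarrow>\<^sub>M count_space UNIV"
    by simp
  note iid = distr_PiM_eq_Pi_pmf[OF prob_space_uniform_unit_interval block distr_block finite_lessThan, of n 0]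
  have "AE y in (\<Pi>\<^sub>M i\<in>{..<n}. ?U). \<forall>i\<in>{..<n}. y i \<in> {0..<1}"
    by (intro AE_finite_allI AE_component AE_uniform_unit_interval) simp_all
  then have "AE y in (\<Pi>\<^sub>M i\<in>{..<n}. ?U). edges_given W n y = edges_given W n (\<sigma> \<circ> ?b y)"
    by eventually_elim (auto intro!: edges_given_block_representatives[OF part])
  from bind_completion_eq[OF iid(1) this P.prob_space_axioms iid(2)] show ?thesis
    unfolding sample_edges_def .
qed

section \<open>Edges of the sample and edges of the skeleton\<close>

text \<open>An edge is placed with positive probability only where \<open>W\<close> does not vanish, so the
  block assignment is a graph homomorphism from the sampled graph to the skeleton.\<close>

lemma edges_given_maps_to_skeleton:
  assumes part: "partition_for W q \<sigma>" and b: "\<And>i. i < n \<Longrightarrow> b i < q"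
    and E: "E \<in> set_pmf (edges_given W n (\<sigma> \<circ> b))" and uv: "{u, v} \<in> E"
  shows "{b u, b v} \<in> skeleton_edges W q \<sigma>"
proof -
  obtain B where B: "B \<in> set_pmf (Pi_pmf {(i, j). i < j \<and> j < n} False
      (\<lambda>(i, j). bernoulli_pmf (W ((\<sigma> \<circ> b) i, (\<sigma> \<circ> b) j))))"
    and E_def: "E = {{i, j} | i j. i < j \<and> j < n \<and> B (i, j)}"
    using E unfolding edges_given_def by auto
  have fin: "finite {(i, j). i < j \<and> j < n}"
    by (rule finite_subset[of _ "{..<n} \<times> {..<n}"]) auto
  obtain i j where ij: "{u, v} = {i, j}" "i < j" "j < n" "B (i, j)"
    using uv by (auto simp: E_def)
  have "True \<in> set_pmf (bernoulli_pmf (W (\<sigma> (b i), \<sigma> (b j))))"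
    using B ij unfolding set_Pi_pmf[OF fin] by (force simp: PiE_dflt_def)
  then have nonzero: "W (\<sigma> (b i), \<sigma> (b j)) \<noteq> 0"
    by (auto simp: set_pmf_iff)
  have less: "b i < q" "b j < q"
    using b ij by auto
  then have "(\<sigma> (b i), \<sigma> (b j)) \<in> rectangle \<sigma> (b i) (b j)"
    using part by (simp add: rectangle_def partition_for_def)
  then have "\<forall>z\<in>rectangle \<sigma> (b i) (b j). W z \<noteq> 0"
    using part less nonzero unfolding partition_for_def constant_on_def by metis
  then have "{b i, b j} \<in> skeleton_edges W q \<sigma>"
    using less by (auto simp: skeleton_edges_def)
  then show ?thesis
    using ij(1) by (auto simp: doubleton_eq_iff insert_commute)
qed

lemma prob_bind_pmf_le:
  assumes "\<And>b x. b \<in> set_pmf p \<Longrightarrow> x \<in> set_pmf (k b) \<Longrightarrow> H x \<Longrightarrow> Q b"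
  shows "measure_pmf.prob (p \<bind> k) {x. H x} \<le> measure_pmf.prob p {b. Q b}"
proof -
  have "emeasure (bind_pmf p k) {x. H x} \<le> (\<integral>\<^sup>+b. indicator {b. Q b} b \<partial>measure_pmf p)"
    unfolding emeasure_bind_pmf
  proof (intro nn_integral_mono_AE AE_pmfI)
    fix b assume b: "b \<in> set_pmf p"
    show "emeasure (measure_pmf (k b)) {x. H x} \<le> indicator {b. Q b} b"
    proof (cases "Q b")
      case False
      then have "AE x in k b. x \<notin> {x. H x}"
        using assms[OF b] by (auto simp: AE_measure_pmf_iff)
      then have "emeasure (measure_pmf (k b)) {x. H x} = 0"
        by (subst (asm) AE_iff_null_sets[symmetric]) auto
      then show ?thesis by simp
    qed (simp add: measure_pmf.emeasure_le_1)
  qed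
  then show ?thesis
    by (simp add: measure_pmf.emeasure_eq_measure)
qed

text \<open>A Hamiltonian decomposition of the sampled graph restricts the block assignment alone: some
  permutation moves every node to a node in an adjacent block. It remains to bound the
  probability that independent blocks have a property \<open>Q\<close> that follows from this.\<close>

lemma prob_hamiltonian_le:
  assumes part: "partition_for W q \<sigma>"
    and P: "measure_pmf P = distr (uniform_measure lborel {0..1}) (count_space UNIV) (block_of \<sigma>)"
    and sub: "set_pmf P \<subseteq> {..<q}"
    and Q: "\<And>b \<pi>. bij_betw \<pi> {..<n} {..<n} \<Longrightarrow>
      (\<And>v. v < n \<Longrightarrow> {b v, b (\<pi> v)} \<in> skeleton_edges W q \<sigma>) \<Longrightarrow> Q b"
  shows "\<P>(E in sample_edges W n. has_hamiltonian_decomposition (directed_version {..<n} E))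
    \<le> measure_pmf.prob (Pi_pmf {..<n} 0 (\<lambda>_. P)) {b. Q b}"
proof -
  have "\<P>(E in sample_edges W n. has_hamiltonian_decomposition (directed_version {..<n} E)) =
      measure_pmf.prob (bind_pmf (Pi_pmf {..<n} 0 (\<lambda>_. P)) (\<lambda>b. edges_given W n (\<sigma> \<circ> b)))
        {E. has_hamiltonian_decomposition (directed_version {..<n} E)}"
    unfolding sample_edges_eq_block_model[OF part P] by simp
  also have "\<dots> \<le> measure_pmf.prob (Pi_pmf {..<n} 0 (\<lambda>_. P)) {b. Q b}"
  proof (rule prob_bind_pmf_le)
    fix b E
    assume b: "b \<in> set_pmf (Pi_pmf {..<n} 0 (\<lambda>_. P))" and E: "E \<in> set_pmf (edges_given W n (\<sigma> \<circ> b))"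
      and "has_hamiltonian_decomposition (directed_version {..<n} E)"
    then obtain \<pi> where \<pi>: "bij_betw \<pi> {..<n} {..<n}" "\<And>v. v \<in> {..<n} \<Longrightarrow> {v, \<pi> v} \<in> E"
      by (elim hamiltonian_decomposition_permutation) blast
    have less: "b i < q" if "i < n" for i
      using b sub that by (auto simp: set_Pi_pmf PiE_dflt_def)
    show "Q b"
    proof (rule Q[OF \<pi>(1)])
      show "{b v, b (\<pi> v)} \<in> skeleton_edges W q \<sigma>" if "v < n" for v
        using edges_given_maps_to_skeleton[OF part less E \<pi>(2)] that by simp
    qed
  qed
  finally show ?thesis .
qed

section \<open>Block counts are binomial\<close>

lemma map_pmf_mem_eq_bernoulli: "map_pmf (\<lambda>x. x \<in> S) P = bernoulli_pmf (measure_pmf.prob P S)"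
proof (rule pmf_eqI)
  fix i
  have "measure_pmf.prob P {x. x \<notin> S} = 1 - measure_pmf.prob P S"
    using measure_pmf.prob_compl[of S P] by (simp add: Compl_eq_Diff_UNIV[symmetric] Compl_eq)
  then show "pmf (map_pmf (\<lambda>x. x \<in> S) P) i = pmf (bernoulli_pmf (measure_pmf.prob P S)) i"
    by (cases i) (simp_all add: pmf_map vimage_def)
qed

text \<open>The number of nodes whose block lies in a given set is a sum of independent coin flips.\<close>

lemma count_Pi_pmf_binomial:
  assumes "finite I"
  shows "map_pmf (\<lambda>b. card {i \<in> I. b i \<in> S}) (Pi_pmf I d (\<lambda>_. P)) =
    binomial_pmf (card I) (measure_pmf.prob P S)"
proof -
  have "binomial_pmf (card I) (measure_pmf.prob P S) =
      map_pmf (\<lambda>f. card {i \<in> I. f i}) (Pi_pmf I (d \<in> S) (\<lambda>_. map_pmf (\<lambda>x. x \<in> S) P))"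
    unfolding map_pmf_mem_eq_bernoulli
    by (rule binomial_pmf_altdef') (simp_all add: assms)
  also have "\<dots> = map_pmf (\<lambda>b. card {i \<in> I. b i \<in> S}) (Pi_pmf I d (\<lambda>_. P))"
    using assms by (simp add: Pi_pmf_map[where dflt = d] pmf.map_comp o_def)
  finally show ?thesis ..
qed

lemma prob_count_Pi_pmf:
  assumes "finite I"
  shows "measure_pmf.prob (Pi_pmf I d (\<lambda>_. P)) {b. R (card {i \<in> I. b i \<in> S})} =
    measure_pmf.prob (binomial_pmf (card I) (measure_pmf.prob P S)) {k. R k}"
  unfolding count_Pi_pmf_binomial[OF assms, of S d P, symmetric] by (simp add: vimage_def)

text \<open>The induction compares consecutive central binomial coefficients: their ratio is
  \<open>2 (2 m + 1) / (m + 1)\<close>, and \<open>(2 m + 1) (2 m + 3) \<le> (2 m + 2)\<^sup>2\<close>. In squared form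
  the bound \<open>4 ^ m / sqrt (2 m + 1)\<close> needs no roots.\<close>

lemma central_binomial_upper_bound: "(2 * m choose m)\<^sup>2 * (2 * m + 1) \<le> 16 ^ m"
proof (induction m)
  case (Suc m)
  define c d where "c = (2 * m choose m)" and "d = (2 * Suc m choose Suc m)"
  have "d = 2 * (Suc (2 * m) choose Suc m)"
    using binomial_symmetric[of m "Suc (2 * m)"] by (simp add: d_def)
  then have rec: "Suc m * d = 2 * Suc (2 * m) * c"
    using Suc_times_binomial_eq[of "2 * m" m] by (simp only: c_def mult_ac)
  have "2 * Suc m + 1 = 2 * m + 3"
    by simp
  then have "(Suc m)\<^sup>2 * (d\<^sup>2 * (2 * Suc m + 1)) = (Suc m * d)\<^sup>2 * (2 * m + 3)"
    by (simp only: power_mult_distrib mult.assoc)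
  also have "\<dots> = 4 * ((2 * m + 1) * (2 * m + 3)) * (c\<^sup>2 * (2 * m + 1))"
    unfolding rec by (simp add: power2_eq_square algebra_simps)
  also have "\<dots> \<le> 4 * (4 * (Suc m)\<^sup>2) * 16 ^ m"
  proof (rule mult_le_mono)
    show "4 * ((2 * m + 1) * (2 * m + 3)) \<le> 4 * (4 * (Suc m)\<^sup>2)"
      by (simp add: power2_eq_square algebra_simps)
    show "c\<^sup>2 * (2 * m + 1) \<le> 16 ^ m"
      using Suc by (simp only: c_def)
  qed
  also have "\<dots> = (Suc m)\<^sup>2 * 16 ^ Suc m"
    by simp
  finally have "d\<^sup>2 * (2 * Suc m + 1) \<le> 16 ^ Suc m"
    by (simp only: mult_le_cancel1) simp
  then show ?case
    by (simp only: d_def)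
qed simp

text \<open>Since \<open>p (1 - p) \<le> 1/4\<close>, an exact tie is most likely for a fair coin, where its
  probability is a normalised central binomial coefficient. The bound is uniform in \<open>p\<close>,
  so that the probability of a colour class need not be known.\<close>

lemma prob_binomial_half_le:
  assumes "p \<in> {0..1}"
  shows "measure_pmf.prob (binomial_pmf n p) {k. 2 * k = n} \<le> 1 / sqrt (n + 1)"
proof (cases "even n")
  case True
  then obtain m where n: "n = 2 * m"
    by blast
  have "(real (2 * m choose m) * sqrt (n + 1))\<^sup>2 \<le> (4 ^ m)\<^sup>2"
  proof -
    have "real ((2 * m choose m)\<^sup>2 * (2 * m + 1)) \<le> real (16 ^ m)"
      using central_binomial_upper_bound by (simp only: of_nat_le_iff)
    moreover have "(4 ^ m)\<^sup>2 = (16 :: real) ^ m"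
      by (simp add: power2_eq_square flip: power_mult_distrib)
    ultimately show ?thesis
      by (simp add: power_mult_distrib n algebra_simps)
  qed
  then have central: "real (2 * m choose m) * sqrt (n + 1) \<le> 4 ^ m"
    by (rule power2_le_imp_le) simp
  have "p * (1 - p) \<le> 1 / 4"
    using zero_le_power2[of "p - 1 / 2"] by (simp add: power2_eq_square algebra_simps)
  then have quarter: "(p * (1 - p)) ^ m \<le> (1 / 4) ^ m"
    using assms by (intro power_mono) auto
  have "measure_pmf.prob (binomial_pmf n p) {k. 2 * k = n} = pmf (binomial_pmf n p) m"
    by (simp add: n measure_pmf_single)
  also have "\<dots> = real (2 * m choose m) * (p * (1 - p)) ^ m"
    using assms by (simp add: n power_mult_distrib)
  also have "\<dots> \<le> real (2 * m choose m) * (1 / 4) ^ m"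
    using quarter by (rule mult_left_mono) simp
  also have "\<dots> \<le> 1 / sqrt (n + 1)"
    using central by (simp add: power_one_over field_simps)
  finally show ?thesis .
next
  case False
  then have "{k. 2 * k = n} = {}"
    by auto
  then show ?thesis
    by simp
qed

section \<open>The edge polytope and the empirical block vector\<close>

text \<open>Loops and proper edges have different generators in the definition of the polytope, but for a
  loop the midpoint of the two equal ends is the generator itself.\<close>

lemma edge_midpoint_in_edge_polytope:
  assumes "{k, l} \<in> F"
  shows "(1/2) *\<^sub>R (Poly_Mapping.single k 1 + Poly_Mapping.single l 1) \<in> edge_polytope F"
proof (cases "k = l")
  case True
  have "(1/2) *\<^sub>R (Poly_Mapping.single k 1 + Poly_Mapping.single k 1) =
      (Poly_Mapping.single k 1 :: ('a, real) poly_mapping)"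
    by (simp flip: scaleR_2)
  then show ?thesis
    using assms True unfolding edge_polytope_def by (intro hull_inc) auto
qed (use assms in \<open>auto simp: edge_polytope_def intro!: hull_inc\<close>)

lemma closed_edge_polytope:
  assumes "finite (\<Union>F)"
  shows "closed (edge_polytope F)"
proof -
  have "finite {(1/2) *\<^sub>R (Poly_Mapping.single k 1 + Poly_Mapping.single l 1) :: ('a, real) poly_mapping
      | k l. k \<noteq> l \<and> {k, l} \<in> F}"
    by (rule finite_subset[of _ "(\<lambda>(k, l). (1/2) *\<^sub>R (Poly_Mapping.single k 1 + Poly_Mapping.single l 1))
        ` (\<Union>F \<times> \<Union>F)"]) (use assms in auto)
  moreover have "finite {Poly_Mapping.single i 1 :: ('a, real) poly_mapping | i. {i} \<in> F}"
    by (rule finite_subset[of _ "(\<lambda>i. Poly_Mapping.single i 1) ` \<Union>F"]) (use assms in auto)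
  ultimately show ?thesis
    unfolding edge_polytope_def
    by (intro compact_imp_closed finite_imp_compact_convex_hull) simp
qed

definition empirical_vector :: "'v set \<Rightarrow> ('v \<Rightarrow> 'a) \<Rightarrow> ('a, real) poly_mapping" where
  "empirical_vector V b = (1 / card V) *\<^sub>R (\<Sum>v\<in>V. Poly_Mapping.single (b v) 1)"

lemma lookup_scaleR_poly_mapping [simp]:
  fixes x :: "('a, real) poly_mapping"
  shows "Poly_Mapping.lookup (r *\<^sub>R x) k = r * Poly_Mapping.lookup x k"
proof -
  have "finite {i. r *\<^sub>R Poly_Mapping.lookup x i \<noteq> 0}"
    by (rule finite_subset[OF _ finite_keys[of x]]) (auto simp: in_keys_iff)
  then show ?thesis
    by (simp add: scaleR_poly_mapping_def Abs_poly_mapping_inverse)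
qed

lemma lookup_empirical_vector:
  assumes "finite V"
  shows "Poly_Mapping.lookup (empirical_vector V b) k = card {v \<in> V. b v = k} / card V"
proof -
  have "(\<Sum>v\<in>V. Poly_Mapping.lookup (Poly_Mapping.single (b v) (1 :: real)) k) = card {v \<in> V. b v = k}"
    using assms by (simp add: lookup_single when_def sum.If_cases Int_def)
  then show ?thesis
    by (simp add: empirical_vector_def lookup_sum)
qed

lemma lookup_concentration_vector:
  "Poly_Mapping.lookup (concentration_vector q \<sigma>) k = (if k < q then \<sigma> (Suc k) - \<sigma> k else 0)"
  by (simp add: concentration_vector_def lookup_sum lookup_single when_def)

lemma dist_poly_mapping_le_sum:
  fixes x y :: "('a, real) poly_mapping"
  assumes "finite K" "\<And>k. k \<notin> K \<Longrightarrow> Poly_Mapping.lookup x k = Poly_Mapping.lookup y k"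
  shows "dist x y \<le> (\<Sum>k\<in>K. \<bar>Poly_Mapping.lookup x k - Poly_Mapping.lookup y k\<bar>)"
proof -
  have "dist x y = (\<Sum>k\<in>(Poly_Mapping.keys x \<union> Poly_Mapping.keys y) \<inter> K.
      \<bar>Poly_Mapping.lookup x k - Poly_Mapping.lookup y k\<bar>)"
    unfolding dist_poly_mapping_def dist_real_def
    by (rule sum.mono_neutral_right) (use assms(2) in auto)
  also have "\<dots> \<le> (\<Sum>k\<in>K. \<bar>Poly_Mapping.lookup x k - Poly_Mapping.lookup y k\<bar>)"
    using assms(1) by (intro sum_mono2) auto
  finally show ?thesis .
qed

text \<open>Let \<open>\<pi>\<close> move every node to an adjacent one. Every node is once a source and once a
  target, so the empirical vector is the average over \<open>v\<close> of the midpoints of the edges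
  \<open>{b v, b (\<pi> v)}\<close>, which are generators of the polytope.\<close>

lemma empirical_vector_in_edge_polytope:
  assumes "finite V" "V \<noteq> {}" and \<pi>: "bij_betw \<pi> V V" "\<And>v. v \<in> V \<Longrightarrow> {b v, b (\<pi> v)} \<in> F"
  shows "empirical_vector V b \<in> edge_polytope F"
proof -
  let ?e = "\<lambda>v. Poly_Mapping.single (b v) (1 :: real)"
  have "(\<Sum>v\<in>V. (1 / card V) *\<^sub>R (1/2) *\<^sub>R (?e v + ?e (\<pi> v))) \<in> edge_polytope F"
    using assms(1,2) edge_midpoint_in_edge_polytope[OF \<pi>(2)]
    by (intro convex_sum) (simp_all add: edge_polytope_def)
  moreover have "(\<Sum>v\<in>V. ?e (\<pi> v)) = (\<Sum>v\<in>V. ?e v)"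
    using \<pi>(1) by (rule sum.reindex_bij_betw)
  ultimately show ?thesis
    by (simp add: empirical_vector_def sum.distrib flip: scaleR_sum_right scaleR_2)
qed

text \<open>A permutation that always changes the colour maps each of the two colour classes injectively
  into the other.\<close>

lemma two_colouring_classes_balanced:
  assumes "finite V" and \<pi>: "bij_betw \<pi> V V" "\<And>v. v \<in> V \<Longrightarrow> c (\<pi> v) \<noteq> c v"
  shows "2 * card {v \<in> V. c v} = card V"
proof -
  have "bij_betw \<pi> {v \<in> V. c v} {v \<in> V. \<not> c v}"
    using \<pi> unfolding bij_betw_def by (auto simp: image_iff inj_on_def) (metis imageE)
  then have "card {v \<in> V. c v} = card {v \<in> V. \<not> c v}"
    by (rule bij_betw_same_card)
  moreover have "card V = card {v \<in> V. c v} + card {v \<in> V. \<not> c v}"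
    using assms(1) by (subst card_Un_disjoint[symmetric]) (auto intro: arg_cong[of _ _ card])
  ultimately show ?thesis
    by simp
qed

section \<open>Vanishing probability of a Hamiltonian decomposition\<close>

theorem theorem1:
  fixes W :: "real \<times> real \<Rightarrow> real" and q :: nat and \<sigma> :: "nat \<Rightarrow> real"
  assumes "step_graphon W"
    and "partition_for W q \<sigma>"
    and "connected_graph {..<q} (skeleton_edges W q \<sigma>)"
    and "\<not> has_odd_cycle {..<q} (skeleton_edges W q \<sigma>) \<or>
         concentration_vector q \<sigma> \<notin> edge_polytope (skeleton_edges W q \<sigma>)"
  shows "(\<lambda>n. \<P>(E in sample_edges W n.
            has_hamiltonian_decomposition (directed_version {..<n} E))) \<longlonglongrightarrow> 0"
    (is "?prob \<longlonglongrightarrow> 0")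
proof -
  note part = assms(2)
  let ?F = "skeleton_edges W q \<sigma>" and ?x = "concentration_vector q \<sigma>"
  have sub: "\<Union>?F \<subseteq> {..<q}"
    by (auto simp: skeleton_edges_def)
  obtain P where P: "measure_pmf P = distr (uniform_measure lborel {0..1}) (count_space UNIV) (block_of \<sigma>)"
    and set_P: "set_pmf P \<subseteq> {..<q}" and pmf_P: "\<And>k. k < q \<Longrightarrow> pmf P k = \<sigma> (Suc k) - \<sigma> k"
    using block_pmf_exists[OF part] by blast
  let ?blocks = "\<lambda>n :: nat. Pi_pmf {..<n} 0 (\<lambda>_. P)"
  from assms(4) show ?thesis
  proof
    assume "\<not> has_odd_cycle {..<q} ?F"
    \<comment> \<open>In a Hamiltonian decomposition the two colour classes contain equally many sampled nodes, and
      the size of a class is binomial, so this exact tie becomes unlikely.\<close>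
    then obtain c :: "nat \<Rightarrow> bool" where c: "\<And>k l. {k, l} \<in> ?F \<Longrightarrow> c k \<noteq> c l"
      by (rule two_colouring_if_no_odd_cycle[OF sub assms(3)]) blast
    have bound: "?prob n \<le> 1 / sqrt (real n + 1)" for n
    proof -
      have "?prob n \<le> measure_pmf.prob (?blocks n) {b. 2 * card {v \<in> {..<n}. b v \<in> Collect c} = n}"
      proof (rule prob_hamiltonian_le[OF part P set_P])
        fix b \<pi> assume "bij_betw \<pi> {..<n} {..<n}" "\<And>v. v < n \<Longrightarrow> {b v, b (\<pi> v)} \<in> ?F"
        then show "2 * card {v \<in> {..<n}. b v \<in> Collect c} = n"
          using two_colouring_classes_balanced[of "{..<n}" \<pi> "\<lambda>v. c (b v)"] c by force
      qed
      also have "\<dots> = measure_pmf.prob (binomial_pmf n (measure_pmf.prob P (Collect c))) {k. 2 * k = n}"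
        by (subst prob_count_Pi_pmf) simp_all
      also have "\<dots> \<le> 1 / sqrt (real n + 1)"
        using prob_binomial_half_le[of "measure_pmf.prob P (Collect c)" n] by (simp add: add.commute)
      finally show ?thesis .
    qed
    have "(\<lambda>n. 1 / sqrt (real n + 1)) \<longlonglongrightarrow> 0"
      by real_asymp
    from tendsto_sandwich[OF _ _ tendsto_const this, of ?prob] show ?thesis
      by (simp add: bound)
  next
    \<comment> \<open>The empirical vector concentrates at its mean \<open>?x\<close>, which has positive distance to the
      closed polytope.\<close>
    assume "?x \<notin> edge_polytope ?F"
    moreover have "finite (\<Union>?F)"
      using sub finite_lessThan by (rule finite_subset)
    ultimately obtain \<epsilon> where "\<epsilon> > 0" and "ball ?x \<epsilon> \<subseteq> - edge_polytope ?F"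
      using closed_edge_polytope[of ?F] openE[of "- edge_polytope ?F" ?x] by blast
    then have \<epsilon>: "\<epsilon> \<le> dist ?x x" if "x \<in> edge_polytope ?F" for x
      using that by (auto simp: subset_iff not_less[symmetric])
    have "q > 0"
      using part by (auto simp: partition_for_def intro: gr0I)
    \<comment> \<open>If all \<open>q\<close> coordinates deviated by less than \<open>\<epsilon> / q\<close>, the distance,
      which is a sum of coordinate deviations, would be less than \<open>\<epsilon>\<close>.\<close>
    define \<delta> where "\<delta> = \<epsilon> / q"
    have "\<delta> > 0"
      using \<open>\<epsilon> > 0\<close> \<open>q > 0\<close> by (simp add: \<delta>_def)
    let ?dev = "\<lambda>(n :: nat) k. {b. \<delta> \<le> \<bar>card {v \<in> {..<n}. b v \<in> {k}} / n - pmf P k\<bar>}"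
    have bound: "?prob n \<le> q * (2 * exp (-2 * n * \<delta>\<^sup>2))" if "n > 0" for n
    proof -
      have "?prob n \<le> measure_pmf.prob (?blocks n) {b. b \<in> (\<Union>k<q. ?dev n k)}"
      proof (rule prob_hamiltonian_le[OF part P set_P])
        fix b \<pi>
        assume \<pi>: "bij_betw \<pi> {..<n} {..<n}" "\<And>v. v < n \<Longrightarrow> {b v, b (\<pi> v)} \<in> ?F"
        then have mem: "empirical_vector {..<n} b \<in> edge_polytope ?F"
          using \<open>n > 0\<close> by (intro empirical_vector_in_edge_polytope) auto
        \<comment> \<open>Skeleton edges only join blocks below \<open>q\<close>, and every node has a successor.\<close>
        have outside: "Poly_Mapping.lookup (empirical_vector {..<n} b) k = 0" if "\<not> k < q" for k
        proof -
          have "b v \<noteq> k" if "v < n" for v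
            using sub \<pi>(2)[OF that] \<open>\<not> k < q\<close> by blast
          then have "{v \<in> {..<n}. b v = k} = {}"
            by blast
          then show ?thesis
            by (simp only: lookup_empirical_vector[OF finite_lessThan]) simp
        qed
        have "(\<Sum>k<q. \<delta>) \<le> dist (empirical_vector {..<n} b) ?x"
          using \<epsilon>[OF mem] \<open>q > 0\<close> by (simp add: \<delta>_def dist_commute)
        also have "\<dots> \<le> (\<Sum>k<q. \<bar>card {v \<in> {..<n}. b v \<in> {k}} / n - pmf P k\<bar>)"
          using dist_poly_mapping_le_sum[of "{..<q}" "empirical_vector {..<n} b" ?x] outside
          by (simp add: lookup_empirical_vector lookup_concentration_vector pmf_P)
        finally have "\<exists>k<q. \<delta> \<le> \<bar>card {v \<in> {..<n}. b v \<in> {k}} / n - pmf P k\<bar>"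
          using sum_strict_mono[of "{..<q}" "\<lambda>k. \<bar>card {v \<in> {..<n}. b v \<in> {k}} / n - pmf P k\<bar>" "\<lambda>_. \<delta>"]
            \<open>q > 0\<close> by (force simp: not_le)
        then show "b \<in> (\<Union>k<q. ?dev n k)"
          by blast
      qed
      also have "\<dots> \<le> (\<Sum>k<q. measure_pmf.prob (?blocks n) (?dev n k))"
        by (simp only: Collect_mem_eq) (rule measure_pmf.finite_measure_subadditive_finite; simp)
      also have "\<dots> \<le> (\<Sum>k<q. 2 * exp (-2 * n * \<delta>\<^sup>2))"
      proof (rule sum_mono)
        fix k
        interpret binomial_distribution n "pmf P k"
          by unfold_locales (simp add: pmf_le_1)
        show "measure_pmf.prob (?blocks n) (?dev n k) \<le> 2 * exp (-2 * n * \<delta>\<^sup>2)"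
          using prob_abs_ge'[OF \<open>n > 0\<close>, of \<delta>] \<open>\<delta> > 0\<close>
          by (subst prob_count_Pi_pmf) (simp_all add: measure_pmf_single)
      qed
      finally show ?thesis
        by simp
    qed
    have lim: "(\<lambda>n. q * (2 * exp (-2 * real n * \<delta>\<^sup>2))) \<longlonglongrightarrow> 0"
      using \<open>\<delta> > 0\<close> by real_asymp
    have "\<forall>\<^sub>F n in sequentially. ?prob n \<le> q * (2 * exp (-2 * real n * \<delta>\<^sup>2))"
      using eventually_gt_at_top[of 0] by eventually_elim (rule bound)
    from tendsto_sandwich[OF _ this tendsto_const lim] show ?thesis
      by simp
  qed
qed

end
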